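(* Let $m\ge1$, and let $w\in\{+,-\}^r$ with $r\ge m-1$. Then, for $1\le k\le r+1$, $$D_w^{(m)}(k)=\sum_{\ell=1}^{m}C_w^{(m)}(\ell)\,\kappa_r^{(m)}(k,\ell).$$
   Context: Rank-vector record sums: let $w=w_1\cdots w_r\in\{+,-\}^r$ and $1\le k\le r+1$. For a permutation (linear ordering) $\alpha=(a_1,\ldots,a_r)$ of the set $[r+1]\setminus\{k\}$, start with threshold $h_0=k$. At step $j$ a record is declared if ($w_j=+$ and $a_j>h_{j-1}$) or ($w_j=-$ and $a_j<h_{j-1}$); on a record set $h_j=a_j$, otherwise $h_j=h_{j-1}$. Let $N_w(\alpha;k)$ be the number of records declared in these $r$ steps (not counting the initial threshold), and $D_w^{(m)}(k)=\sum_\alpha m^{N_w(\alpha;k)}$, summed over all permutations of $[r+1]\setminus\{k\}$. Endpoint counts: for $1\le \ell\le m$, $C_w^{(m)}(\ell)$ counts sequences $(g_0,\ldots,g_r)\in[m]^{r+1}$ with $g_0=\ell$ such that $g_j\ge g_{j-1}$ if $w_j=+$ and $g_j\le g_{j-1}$ if $w_j=-$, for $1\le j\le r$. Kernel: for $r\ge m-1$, $1\le k\le r+1$, $1\le\ell\le m$, $$\kappa_r^{(m)}(k,\ell)=(k-1)!\,(r+1-k)!\binom{m-1}{\ell-1}\binom{r-m+1}{k-\ell},$$ with $\binom ab=0$ when $b<0$ or $b>a$. *)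

theory Defs
  imports Complex_Main "HOL-Combinatorics.Multiset_Permutations"
begin

text \<open>Words over \<open>{+,-}\<close> are lists; the letter \<open>w\<^sub>j\<close> is \<open>w ! (j - 1)\<close> and \<open>r = length w\<close>.\<close>

datatype sign = Plus | Minus

fun is_record :: "sign \<Rightarrow> nat \<Rightarrow> nat \<Rightarrow> bool" where
  "is_record Plus h a \<longleftrightarrow> a > h"
| "is_record Minus h a \<longleftrightarrow> a < h"

text \<open>\<open>records w \<alpha> h\<close> is \<open>N\<^sub>w(\<alpha>; h)\<close>: the second list is the permutation, the last argument the
  current threshold. Only lists of equal length are used; the final equation merely makes the
  function total.\<close>

fun records :: "sign list \<Rightarrow> nat list \<Rightarrow> nat \<Rightarrow> nat" where
  "records (s # w) (a # \<alpha>) h =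
     (if is_record s h a then Suc (records w \<alpha> a) else records w \<alpha> h)"
| "records _ _ _ = 0"

definition record_sum :: "nat \<Rightarrow> sign list \<Rightarrow> nat \<Rightarrow> nat" where
  "record_sum m w k =
     (\<Sum>\<alpha> \<in> permutations_of_set ({1..length w + 1} - {k}). m ^ records w \<alpha> k)"

definition endpoint_count :: "nat \<Rightarrow> sign list \<Rightarrow> nat \<Rightarrow> nat" where
  "endpoint_count m w l =
     card {g :: nat list. length g = length w + 1 \<and> set g \<subseteq> {1..m} \<and> g ! 0 = l \<and>
       (\<forall>j \<in> {1..length w}. case w ! (j - 1) of
          Plus \<Rightarrow> g ! j \<ge> g ! (j - 1)
        | Minus \<Rightarrow> g ! j \<le> g ! (j - 1))}"

text \<open>Binomial coefficients vanishing for negative lower index; plain subtraction on \<open>nat\<close>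
  would turn \<open>k - l\<close> into \<open>0\<close> for \<open>k < l\<close>.\<close>

definition binom :: "nat \<Rightarrow> int \<Rightarrow> nat" where
  "binom a b = (if b < 0 then 0 else a choose nat b)"

text \<open>The upper index \<open>r + 1 - m\<close> is the true difference when \<open>r \<ge> m - 1\<close>.\<close>

definition record_kernel :: "nat \<Rightarrow> nat \<Rightarrow> nat \<Rightarrow> nat \<Rightarrow> nat" where
  "record_kernel m r k l =
     fact (k - 1) * fact (r + 1 - k) * binom (m - 1) (int l - 1) * binom (r + 1 - m) (int k - int l)"

end

theory Submission
  imports Defs
begin

text \<open>
  Shift all indices to start at zero: \<open>p = m - 1\<close>, \<open>x = k - 1\<close>, \<open>y = l - 1\<close>, \<open>r = length w\<close>, and
  write \<open>D\<^sub>w(x)\<close> and \<open>C\<^sub>w(y)\<close> for the record sum and the endpoint count. Removing the first letter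
  of the word turns both into one-step recursions. A first entry of the permutation either becomes
  the threshold or leaves it unchanged, and in both cases the other entries can be relabelled to be an
  interval; this gives
  \<open>D\<^bsub>+w\<^esub>(x) = x D\<^sub>w(x - 1) + m \<Sum>\<^bsub>j \<ge> x\<^esub> D\<^sub>w(j)\<close>, and \<open>C\<^bsub>+w\<^esub>(y) = \<Sum>\<^bsub>i \<ge> y\<^esub> C\<^sub>w(i)\<close>, with the mirror
  images for the letter minus.

  The kernel is hypergeometric: it equals \<open>p! (r - p)!\<close> times
  \<open>(x choose y) (r - x choose p - y)\<close>. So \<open>D\<^sub>w(x) / r!\<close> is the average of \<open>C\<^sub>w\<close> at the rank of \<open>x\<close> in
  a random \<open>m\<close>-element subset of \<open>{0..r}\<close> that contains \<open>x\<close>, ranks being counted from zero. The natural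
  proof, induction on the word, needs the kernel to intertwine the two recursions. This works for
  \<open>r > p\<close>, but the induction would then have to start at \<open>r = p\<close>, where the claim
  \<open>D\<^sub>w = p! C\<^sub>w\<close> is not obvious, and for shorter words the kernel makes no sense.

  For \<open>r \<le> p\<close> the roles are exchanged: \<open>C\<^sub>w(y)\<close> is the average of \<open>D\<^sub>w / r!\<close> at the rank of \<open>y\<close> in a random
  subset of \<open>{0..p}\<close> with \<open>r + 1\<close> elements, one of them \<open>y\<close>. This dual statement,
  \<open>endpoint_count_by_record_sum\<close>, can be proved by induction from the empty word, and at \<open>r = p\<close>
  both kernels are diagonal, so it supplies the start of the induction in
  \<open>record_sum_by_endpoint_count\<close>.

  Both intertwining identities come down to one fact about the hypergeometric tail
  \<open>\<Sum>\<^bsub>y \<le> i\<^esub> (x choose y) (b choose n - y)\<close>: moving one point from the second block to the first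
  changes it by a single product of binomial coefficients.
\<close>

section \<open>Hypergeometric kernel identities\<close>

lemma binomial_absorb_comp_pred_int:
  "int n * int (n - 1 choose i) = (int n - int i) * int (n choose i)"
proof (cases "i \<le> n")
  case True
  have "(n - i) * (n choose i) = n * (n - 1 choose i)"
    by (cases n) (auto simp: binomial_absorb_comp)
  then show ?thesis using True by (metis of_nat_diff of_nat_mult)
qed (auto simp: binomial_eq_0)

lemma binomial_absorption_int:
  "int (Suc i) * int (n choose Suc i) = (int n - int i) * int (n choose i)"
proof -
  have "Suc i * (n choose Suc i) = n * (n - 1 choose i)"
    by (rule binomial_absorption)
  then have "int (Suc i) * int (n choose Suc i) = int n * int (n - 1 choose i)"
    by (metis of_nat_mult)
  then show ?thesis by (simp only: binomial_absorb_comp_pred_int)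
qed

text \<open>The sum counts the subsets of size \<open>i + q\<close> of \<open>x + Suc b\<close> points with at most \<open>i\<close> members among the
  first \<open>x\<close>. When point number \<open>x + 1\<close> joins the first block, exactly those subsets are lost that
  contain it and have \<open>i\<close> members before it, hence \<open>q - 1\<close> after it.\<close>

lemma hypergeometric_tail_step:
  "(\<Sum>y\<le>i. (x choose y) * (Suc b choose (i + q - y))) =
   (\<Sum>y\<le>i. (Suc x choose y) * (b choose (i + q - y))) +
   (case q of 0 \<Rightarrow> 0 | Suc q' \<Rightarrow> (x choose i) * (b choose q'))"
proof (induction i arbitrary: q)
  case 0
  then show ?case by (cases q) auto
next
  case (Suc i)
  have "(\<Sum>y\<le>Suc i. (x choose y) * (Suc b choose (Suc i + q - y))) =
     (\<Sum>y\<le>i. (x choose y) * (Suc b choose (i + Suc q - y))) + (x choose Suc i) * (Suc b choose q)"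
    by simp
  also have "\<dots> = (\<Sum>y\<le>i. (Suc x choose y) * (b choose (i + Suc q - y))) + (x choose i) * (b choose q)
      + (x choose Suc i) * (Suc b choose q)"
    by (simp only: Suc.IH nat.case)
  finally show ?case by (cases q) (auto simp: algebra_simps)
qed

text \<open>The intertwining identity for long words, up to factorial factors: the kernel for length
  \<open>x + b\<close> and \<open>p = i + q\<close>, summed over the starting points from which \<open>i\<close> can be reached by a weak
  ascent, is the record recursion for plus applied to the kernel for length \<open>x + b - 1\<close>. It is proved with
  \<open>x + b\<close> fixed, by moving the boundary down from \<open>x + b\<close>: the tail on the left changes by one product
  and the sum over \<open>j\<close> on the right by one term.\<close>

lemma long_word_kernel_plus:
  assumes "i + q \<le> x + b"
  shows "(x + b - (i + q)) * (\<Sum>y\<le>i. (x choose y) * (b choose (i + q - y))) =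
    x * (x - 1 choose i) * (b choose q) +
    (i + q + 1) * (\<Sum>j=x..<x + b. (j choose i) * ((x + b - 1 - j) choose q))"
  using assms
proof (induction b arbitrary: x)
  case 0
  show ?case
  proof (cases q)
    case 0
    have "(x - i) * (x choose i) = x * (x - 1 choose i)"
      by (cases x) (auto simp: binomial_absorb_comp)
    moreover have "(\<Sum>y\<le>i. (x choose y) * (0 choose (i - y))) = (x choose i)"
      by (subst sum.mono_neutral_right[of _ "{i}"]) auto
    ultimately show ?thesis using 0 by simp
  next
    case (Suc q')
    have "(\<Sum>y\<le>i. (x choose y) * (0 choose (i + q - y))) = 0"
      using Suc by (intro sum.neutral) auto
    then show ?thesis using Suc by simp
  qed
next
  case (Suc b)
  define S where "S = (\<Sum>y\<le>i. (Suc x choose y) * (b choose (i + q - y)))"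
  define R where "R = (\<Sum>j=Suc x..<Suc x + b. (j choose i) * ((x + b - j) choose q))"
  have split: "(\<Sum>j=x..<x + Suc b. (j choose i) * ((x + Suc b - 1 - j) choose q)) = (x choose i) * (b choose q) + R"
    by (subst sum.atLeast_Suc_lessThan) (auto simp: R_def)
  have IH: "(Suc x + b - (i + q)) * S = Suc x * (x choose i) * (b choose q) + (i + q + 1) * R"
    using Suc.IH[of "Suc x"] Suc.prems by (simp add: S_def R_def)
  note a = binomial_absorb_comp_pred_int[of x i]
  show ?case
  proof (cases q)
    case 0
    have n: "x * (x - 1 choose i) + i * (x choose i) = x * (x choose i)"
      by (rule of_nat_eq_iff[where 'a=int, THEN iffD1]) (use a in \<open>simp add: algebra_simps\<close>)
    have "(x + Suc b - (i + q)) * S = Suc x * (x choose i) + (i + q + 1) * R"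
      using IH 0 by simp
    also have "Suc x * (x choose i) = x * (x - 1 choose i) + (i + 1) * (x choose i)"
      using n by simp
    finally show ?thesis unfolding hypergeometric_tail_step split S_def[symmetric]
      by (simp add: 0 algebra_simps)
  next
    case (Suc q')
    have IH': "int (Suc x + b - (i + q)) * int S = int (Suc x) * int (x choose i) * int (b choose q) + int (i + q + 1) * int R"
      using IH by (metis of_nat_add of_nat_mult)
    have e: "int (Suc x + b - (i + q)) = int x + int b - int i - int q'"
      using Suc.prems Suc by (simp)
    note ab = binomial_absorption_int[of q' b]
    (* By the induction hypothesis, the two sides differ by x choose i times the absorption law ab. *)
    have g: "(int x + int b - int i - int q') * (int S + int (x choose i) * int (b choose q')) =
       (int x - int i) * int (x choose i) * (int (b choose Suc q') + int (b choose q')) +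
       (int i + int q' + 2) * (int (x choose i) * int (b choose Suc q') + int R)"
      using IH'[unfolded e, unfolded Suc of_nat_add of_nat_Suc of_nat_1] ab[unfolded of_nat_Suc]
      by algebra
    have "int ((x + Suc b - (i + q)) * (S + (x choose i) * (b choose q'))) =
      int (x * (x - 1 choose i) * (Suc b choose q) + (i + q + 1) * ((x choose i) * (b choose q) + R))"
      unfolding of_nat_add of_nat_mult a using g e Suc by (simp add: algebra_simps)
    then show ?thesis unfolding hypergeometric_tail_step split S_def[symmetric]
      unfolding Suc nat.case by (simp only: of_nat_eq_iff Suc)
  qed
qed

text \<open>The dual identity for words shorter than \<open>m\<close>. Again \<open>y + b\<close> is fixed; the sum over \<open>i\<close> is now on
  the left and the tail on the right.\<close>

lemma short_word_kernel_plus: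
  assumes "j + q < y + b"
  shows "(y + b - (j + q)) * (\<Sum>i=y..y + b. (i choose j) * ((y + b - i) choose q)) =
    Suc j * (y choose Suc j) * (b choose q) +
    (y + b + 1) * (\<Sum>x\<le>j. (y choose x) * (b choose (j + Suc q - x)))"
  using assms
proof (induction b arbitrary: y)
  case 0
  have z: "(\<Sum>x\<le>j. (y choose x) * (0 choose (j + Suc q - x))) = 0"
    by (intro sum.neutral) auto
  have "Suc j * (y choose Suc j) = (y - j) * (y choose j)"
    by (metis binomial_absorb_comp binomial_absorption mult.commute)
  then show ?case unfolding z by (cases q) (auto simp: algebra_simps)
next
  case (Suc b)
  define S where "S = (\<Sum>x\<le>j. (Suc y choose x) * (b choose (j + Suc q - x)))"
  define R where "R = (\<Sum>i=Suc y..Suc y + b. (i choose j) * ((Suc y + b - i) choose q))"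
  have split: "(\<Sum>i=y..y + Suc b. (i choose j) * ((y + Suc b - i) choose q)) = (y choose j) * (Suc b choose q) + R"
    by (subst sum.atLeast_Suc_atMost) (auto simp: R_def)
  have tail: "(\<Sum>x\<le>j. (y choose x) * (Suc b choose (j + Suc q - x))) = S + (y choose j) * (b choose q)"
    unfolding hypergeometric_tail_step S_def by simp
  have IH: "(Suc y + b - (j + q)) * R = Suc j * (Suc y choose Suc j) * (b choose q) + (Suc y + b + 1) * S"
    using Suc.IH[of "Suc y"] Suc.prems by (simp only: S_def R_def)
  note a1 = binomial_absorption_int[of j y]
  have a2: "int (Suc j) * int (Suc y choose Suc j) = (int y + 1) * int (y choose j)"
    using Suc_times_binomial_eq[of y j] by (metis mult.commute of_nat_Suc of_nat_mult add.commute)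
  have a3: "(int b + 1 - int q) * int (Suc b choose q) = (int b + 1) * int (b choose q)"
    using binomial_absorb_comp_pred_int[of "Suc b" q] by (simp add: algebra_simps)
  have e: "int (Suc y + b - (j + q)) = int y + int b + 1 - int j - int q"
      using Suc.prems by simp
  have IH': "(int y + int b + 1 - int j - int q) * int R = (int y + 1) * int (y choose j) * int (b choose q) + (int y + int b + 2) * int S"
    using arg_cong[OF IH, of int] unfolding of_nat_mult of_nat_add e[unfolded of_nat_add] a2
    by (simp add: algebra_simps)
  (* By the induction hypothesis, the two sides differ by y choose j times the absorption law a3. *)
  have g: "(int y + int b + 1 - int j - int q) * (int (y choose j) * int (Suc b choose q) + int R) =
     (int y - int j) * int (y choose j) * int (Suc b choose q) + (int y + int b + 2) * (int S + int (y choose j) * int (b choose q))"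
    using IH' a3 by algebra
  have "int ((y + Suc b - (j + q)) * ((y choose j) * (Suc b choose q) + R)) =
     int (Suc j * (y choose Suc j) * (Suc b choose q) + (y + Suc b + 1) * (S + (y choose j) * (b choose q)))"
    unfolding of_nat_add of_nat_mult a1 using g e by (simp add: algebra_simps)
  then show ?case unfolding split tail by (simp only: of_nat_eq_iff)
qed

text \<open>The identities for the letter minus are the mirror images: exchange the two blocks and count
  from the other end.\<close>

lemma long_word_kernel_minus:
  assumes "i + q \<le> x + b"
  shows "(x + b - (i + q)) * (\<Sum>y=i..i + q. (x choose y) * (b choose (i + q - y))) =
    b * (x choose i) * (b - 1 choose q) +
    (i + q + 1) * (\<Sum>j<x. (j choose i) * ((x + b - 1 - j) choose q))"
proof -
  have "(\<Sum>y\<le>q. (b choose y) * (x choose (q + i - y))) =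
      (\<Sum>y=i..i + q. (x choose y) * (b choose (i + q - y)))"
    by (rule sum.reindex_bij_witness[of _ "\<lambda>y. i + q - y" "\<lambda>y. i + q - y"]) (auto simp: add.commute)
  moreover have "(\<Sum>j=b..<b + x. (j choose q) * ((b + x - 1 - j) choose i)) =
      (\<Sum>j<x. (j choose i) * ((x + b - 1 - j) choose q))"
    by (rule sum.reindex_bij_witness[of _ "\<lambda>j. x + b - 1 - j" "\<lambda>j. x + b - 1 - j"]) (auto simp: add.commute)
  ultimately show ?thesis
    using long_word_kernel_plus[of q i b x] assms by (simp add: ac_simps)
qed

lemma short_word_kernel_minus:
  assumes "j + q < y + b"
  shows "(y + b - (j + q)) * (\<Sum>i\<le>y. (i choose j) * ((y + b - i) choose q)) =
    Suc q * (y choose j) * (b choose Suc q) +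
    (y + b + 1) * (\<Sum>x=Suc j..j + Suc q. (y choose x) * (b choose (j + Suc q - x)))"
proof -
  have "(\<Sum>i=b..b + y. (i choose q) * ((b + y - i) choose j)) =
      (\<Sum>i\<le>y. (i choose j) * ((y + b - i) choose q))"
    by (rule sum.reindex_bij_witness[of _ "\<lambda>i. y + b - i" "\<lambda>i. y + b - i"]) (auto simp: add.commute)
  moreover have "(\<Sum>x\<le>q. (b choose x) * (y choose (q + Suc j - x))) =
      (\<Sum>x=Suc j..j + Suc q. (y choose x) * (b choose (j + Suc q - x)))"
    by (rule sum.reindex_bij_witness[of _ "\<lambda>x. j + Suc q - x" "\<lambda>x. j + Suc q - x"]) (auto simp: add.commute)
  ultimately show ?thesis
    using short_word_kernel_plus[of q j b y] assms by (simp only: ac_simps)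
qed

section \<open>Recursion for record sums\<close>

text \<open>The record sum over an arbitrary set of entries. Deleting the first entry of a permutation
  leaves a set with gaps, which has to be relabelled before the recursion closes.\<close>

definition threshold_sum :: "nat \<Rightarrow> sign list \<Rightarrow> nat set \<Rightarrow> nat \<Rightarrow> nat" where
  "threshold_sum m w S h = (\<Sum>\<alpha> \<in> permutations_of_set S. m ^ records w \<alpha> h)"

lemma record_sum_eq_threshold_sum:
  "record_sum m w k = threshold_sum m w ({1..length w + 1} - {k}) k"
  by (simp add: record_sum_def threshold_sum_def)

text \<open>Records depend only on the relative order of the entries and the threshold.\<close>

lemma records_map:
  assumes "strict_mono_on A f" "insert h (set \<alpha>) \<subseteq> A"
  shows "records w (map f \<alpha>) (f h) = records w \<alpha> h"
  using assms(2)
proof (induction w \<alpha> h rule: records.induct)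
  case (1 s w a \<alpha> h)
  then have "is_record s (f h) (f a) = is_record s h a"
    using strict_mono_on_less[OF assms(1)] by (cases s) auto
  then show ?case using 1 by auto
qed auto

lemma threshold_sum_image:
  assumes "strict_mono_on (insert h S) f"
  shows "threshold_sum m w (f ` S) (f h) = threshold_sum m w S h"
proof -
  have inj: "inj_on f S"
    using strict_mono_on_imp_inj_on[OF assms] by (rule inj_on_subset) auto
  have inj': "inj_on (map f) (permutations_of_set S)"
    by (rule inj_on_subset[OF inj_on_mapI, of f "permutations_of_set S"])
      (use inj in \<open>auto simp: permutations_of_set_def inj_on_def\<close>)
  show ?thesis
    unfolding threshold_sum_def permutations_of_set_image_inj[OF inj] sum.reindex[OF inj'] o_def
    by (intro sum.cong refl arg_cong[of _ _ "power m"] records_map[OF assms])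
      (auto simp: permutations_of_set_def)
qed

lemma threshold_sum_Cons:
  assumes "finite S" "S \<noteq> {}"
  shows "threshold_sum m (s # w) S h =
    (\<Sum>a\<in>S. if is_record s h a then m * threshold_sum m w (S - {a}) a
                               else threshold_sum m w (S - {a}) h)"
proof -
  have "threshold_sum m (s # w) S h =
      (\<Sum>a\<in>S. \<Sum>\<alpha>\<in>(#) a ` permutations_of_set (S - {a}). m ^ records (s # w) \<alpha> h)"
    unfolding threshold_sum_def permutations_of_set_nonempty[OF assms(2)]
    using assms(1) by (intro sum.UNION_disjoint) auto
  also have "\<dots> = (\<Sum>a\<in>S. if is_record s h a then m * threshold_sum m w (S - {a}) a
                               else threshold_sum m w (S - {a}) h)"
    by (intro sum.cong refl)
      (simp add: sum.reindex threshold_sum_def sum_distrib_left)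
  finally show ?thesis .
qed

text \<open>Here \<open>c\<close> is the value that drops out of play: the first entry if it is not a record, the old
  threshold if it is. Closing the gap at \<open>c\<close> moves the values above it down by one.\<close>

lemma threshold_sum_remove:
  assumes "c \<in> {1..length w + 2}" "h \<in> {1..length w + 2}" "h \<noteq> c"
  shows "threshold_sum m w ({1..length w + 2} - {c} - {h}) h =
    record_sum m w (if h < c then h else h - 1)"
proof -
  define f where "f = (\<lambda>t. if t < c then t else t - 1 :: nat)"
  have mono: "strict_mono_on ({1..length w + 2} - {c}) f"
    by (auto simp: strict_mono_on_def f_def)
  have img: "f ` ({1..length w + 2} - {c}) = {1..length w + 1}"
  proof (intro set_eqI iffI)
    fix t assume t: "t \<in> {1..length w + 1}"
    show "t \<in> f ` ({1..length w + 2} - {c})"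
      using t assms(1) by (intro image_eqI[of _ _ "if t < c then t else Suc t"]) (auto simp: f_def)
  qed (use assms(1) in \<open>auto simp: f_def\<close>)
  have "f ` ({1..length w + 2} - {c} - {h}) = f ` ({1..length w + 2} - {c}) - f ` {h}"
    using assms by (intro inj_on_image_set_diff[OF strict_mono_on_imp_inj_on[OF mono]]) auto
  then have "f ` ({1..length w + 2} - {c} - {h}) = {1..length w + 1} - {f h}"
    by (simp only: img image_insert image_empty)
  moreover have "insert h ({1..length w + 2} - {c} - {h}) = {1..length w + 2} - {c}"
    using assms by auto
  ultimately have "threshold_sum m w ({1..length w + 2} - {c} - {h}) h = record_sum m w (f h)"
    using threshold_sum_image[of h "{1..length w + 2} - {c} - {h}" f m w] mono
    by (simp only: record_sum_eq_threshold_sum)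
  then show ?thesis by (simp add: f_def)
qed

lemma record_sum_Cons:
  assumes "k \<in> {1..length w + 2}"
  shows "record_sum m (s # w) k = (\<Sum>a\<in>{1..length w + 2} - {k}.
     if is_record s k a then m * record_sum m w (if a < k then a else a - 1)
     else record_sum m w (if k < a then k else k - 1))"
proof -
  have ne: "{1..length w + 2} - {k} \<noteq> {}"
  proof
    assume "{1..length w + 2} - {k} = {}"
    then have "card {1..length w + 2} \<le> card {k}" by (intro card_mono) auto
    then show False by simp
  qed
  have "record_sum m (s # w) k = threshold_sum m (s # w) ({1..length w + 2} - {k}) k"
    by (simp add: record_sum_eq_threshold_sum)
  also have "\<dots> = (\<Sum>a\<in>{1..length w + 2} - {k}.
     if is_record s k a then m * record_sum m w (if a < k then a else a - 1)
     else record_sum m w (if k < a then k else k - 1))"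
    unfolding threshold_sum_Cons[OF finite_Diff[OF finite_atLeastAtMost] ne]
  proof (intro sum.cong refl if_cong arg_cong2[of _ _ _ _ "(*)"])
    fix a assume a: "a \<in> {1..length w + 2} - {k}"
    show "threshold_sum m w ({1..length w + 2} - {k} - {a}) a = record_sum m w (if a < k then a else a - 1)"
      using a assms by (intro threshold_sum_remove) auto
    have "{1..length w + 2} - {k} - {a} = {1..length w + 2} - {a} - {k}" by auto
    then show "threshold_sum m w ({1..length w + 2} - {k} - {a}) k = record_sum m w (if k < a then k else k - 1)"
      using a assms threshold_sum_remove[of a w k m] by simp
  qed
  finally show ?thesis .
qed

lemma sum_interval_minus_point:
  assumes "x \<le> n"
  shows "(\<Sum>a\<in>{1..Suc n} - {Suc x}. f a) = (\<Sum>a<x. f (Suc a)) + (\<Sum>a=x..<n. f (a + 2 :: nat) :: nat)"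
proof -
  have "(\<Sum>a\<in>{1..Suc n} - {Suc x}. f a) = sum f {1..x} + sum f {x+2..Suc n}"
    using assms by (subst sum.union_disjoint[symmetric]) (auto intro!: sum.cong)
  also have "sum f {1..x} = (\<Sum>a<x. f (Suc a))"
    by (rule sum.reindex_bij_witness[of _ Suc "\<lambda>a. a - 1"]) auto
  also have "sum f {x+2..Suc n} = (\<Sum>a=x..<n. f (a + 2))"
    by (rule sum.reindex_bij_witness[of _ "\<lambda>a. a + 2" "\<lambda>a. a - 2"])
      (auto simp: le_imp_diff_is_add simp flip: add_2_eq_Suc')
  finally show ?thesis .
qed

text \<open>The \<open>x\<close> smaller first entries keep the threshold and lower its rank by one; a larger first entry
  earns a factor \<open>m\<close> and becomes the threshold. For \<open>x = 0\<close> the term \<open>record_sum m w 0\<close> lies outside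
  the meaningful range but has coefficient zero.\<close>

lemma record_sum_Plus:
  assumes "x \<le> length w + 1"
  shows "record_sum m (Plus # w) (Suc x) =
    x * record_sum m w x + m * (\<Sum>j=x..<length w + 1. record_sum m w (Suc j))"
  using assms sum_interval_minus_point[of x "length w + 1"]
  by (simp add: record_sum_Cons sum_distrib_left del: sum.op_ivl_Suc)

lemma record_sum_Minus:
  assumes "x \<le> length w + 1"
  shows "record_sum m (Minus # w) (Suc x) =
    (length w + 1 - x) * record_sum m w (Suc x) + m * (\<Sum>j<x. record_sum m w (Suc j))"
  using assms sum_interval_minus_point[of x "length w + 1"]
  by (simp add: record_sum_Cons sum_distrib_left del: sum.op_ivl_Suc)

lemma record_sum_Nil: "record_sum m [] (Suc 0) = 1"
  by (simp add: record_sum_def)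

section \<open>Recursion for endpoint counts\<close>

definition follows :: "sign list \<Rightarrow> nat list \<Rightarrow> bool" where
  "follows w g \<longleftrightarrow> (\<forall>j \<in> {1..length w}. case w ! (j - 1) of
      Plus \<Rightarrow> g ! j \<ge> g ! (j - 1) | Minus \<Rightarrow> g ! j \<le> g ! (j - 1))"

lemma follows_Cons:
  "follows (s # w) (l # g) \<longleftrightarrow> (case s of Plus \<Rightarrow> l \<le> g ! 0 | Minus \<Rightarrow> g ! 0 \<le> l) \<and> follows w g"
proof -
  have "(\<forall>j\<in>{1..Suc n}. P j) \<longleftrightarrow> P 1 \<and> (\<forall>j\<in>{1..n}. P (Suc j))" for P and n :: nat
  proof -
    have "{1..Suc n} = insert 1 (Suc ` {1..n})"
      unfolding image_Suc_atLeastAtMost by auto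
    then show ?thesis by (simp only: ball_simps)
  qed
  moreover have "(s # w) ! j = w ! (j - 1) \<and> (l # g) ! j = g ! (j - 1)" if "j \<in> {1..length w}" for j
    using that by (simp add: nth_Cons')
  ultimately show ?thesis
    by (simp add: follows_def cong: sign.case_cong)
qed

definition walks :: "nat \<Rightarrow> sign list \<Rightarrow> nat \<Rightarrow> nat list set" where
  "walks m w l = {g. length g = length w + 1 \<and> set g \<subseteq> {1..m} \<and> g ! 0 = l \<and> follows w g}"

lemma endpoint_count_eq_card_walks: "endpoint_count m w l = card (walks m w l)"
  by (simp add: endpoint_count_def walks_def follows_def)

lemma finite_walks: "finite (walks m w l)"
  by (rule finite_subset[OF _ finite_lists_length_eq[of "{1..m}" "length w + 1"]])
    (auto simp: walks_def)

lemma walks_Cons: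
  assumes "l \<in> {1..m}"
  shows "walks m (s # w) l =
    (\<Union>i\<in>{i\<in>{1..m}. case s of Plus \<Rightarrow> l \<le> i | Minus \<Rightarrow> i \<le> l}. (#) l ` walks m w i)"
    (is "_ = ?U")
proof (rule set_eqI)
  fix g
  show "g \<in> walks m (s # w) l \<longleftrightarrow> g \<in> ?U"
  proof (cases g)
    case (Cons l' g')
    have "g' ! 0 \<in> {1..m}" if "length g' = length w + 1" "set g' \<subseteq> {1..m}"
      using that by (intro subsetD[OF that(2)] nth_mem) simp
    moreover have "l' # g' \<in> (#) l ` A \<longleftrightarrow> l' = l \<and> g' \<in> A" for A
      by auto
    ultimately show ?thesis
      using assms by (auto simp: Cons walks_def follows_Cons)
  qed (auto simp: walks_def)
qed

lemma endpoint_count_Cons: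
  assumes "l \<in> {1..m}"
  shows "endpoint_count m (s # w) l =
    (\<Sum>i\<in>{i\<in>{1..m}. case s of Plus \<Rightarrow> l \<le> i | Minus \<Rightarrow> i \<le> l}. endpoint_count m w i)"
proof -
  have "card (walks m (s # w) l) =
      (\<Sum>i\<in>{i\<in>{1..m}. case s of Plus \<Rightarrow> l \<le> i | Minus \<Rightarrow> i \<le> l}. card ((#) l ` walks m w i))"
    unfolding walks_Cons[OF assms]
  proof (rule card_UN_disjoint)
    show "\<forall>i\<in>{i\<in>{1..m}. case s of Plus \<Rightarrow> l \<le> i | Minus \<Rightarrow> i \<le> l}.
        \<forall>i'\<in>{i\<in>{1..m}. case s of Plus \<Rightarrow> l \<le> i | Minus \<Rightarrow> i \<le> l}.
          i \<noteq> i' \<longrightarrow> (#) l ` walks m w i \<inter> (#) l ` walks m w i' = {}"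
      by (auto simp: walks_def)
  qed (auto simp: finite_walks)
  then show ?thesis
    by (simp add: endpoint_count_eq_card_walks card_image)
qed

lemma endpoint_count_Plus:
  assumes "y \<le> p"
  shows "endpoint_count (Suc p) (Plus # w) (Suc y) = (\<Sum>i=y..p. endpoint_count (Suc p) w (Suc i))"
  using assms by (subst endpoint_count_Cons, simp)
    (rule sum.reindex_bij_witness[of _ Suc "\<lambda>i. i - 1"], auto)

lemma endpoint_count_Minus:
  assumes "y \<le> p"
  shows "endpoint_count (Suc p) (Minus # w) (Suc y) = (\<Sum>i\<le>y. endpoint_count (Suc p) w (Suc i))"
  using assms by (subst endpoint_count_Cons, simp)
    (rule sum.reindex_bij_witness[of _ Suc "\<lambda>i. i - 1"], auto)

lemma endpoint_count_Nil:
  assumes "l \<in> {1..m}"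
  shows "endpoint_count m [] l = 1"
proof -
  have "{g. length g = 1 \<and> set g \<subseteq> {1..m} \<and> g ! 0 = l} = {[l]}"
    using assms by (auto simp: length_Suc_conv)
  then show ?thesis by (simp add: endpoint_count_def)
qed

section \<open>Transposed recursions\<close>

lemma sum_swap_weighted:
  fixes f :: "'a \<Rightarrow> nat" and g :: "'b \<Rightarrow> nat"
  assumes "finite A" "finite B"
    and "\<And>x. x \<in> A \<Longrightarrow> P x \<subseteq> B" "\<And>j. j \<in> B \<Longrightarrow> Q j \<subseteq> A"
    and "\<And>x j. x \<in> A \<Longrightarrow> j \<in> B \<Longrightarrow> j \<in> P x \<longleftrightarrow> x \<in> Q j"
  shows "(\<Sum>x\<in>A. f x * sum g (P x)) = (\<Sum>j\<in>B. g j * sum f (Q j))"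
proof -
  have P: "{j \<in> B. j \<in> P x} = P x" if "x \<in> A" for x
    using assms(3)[OF that] by auto
  have Q: "{x \<in> A. j \<in> P x} = Q j" if "j \<in> B" for j
    using assms(4,5) that by blast
  have "(\<Sum>x\<in>A. f x * sum g (P x)) = (\<Sum>x\<in>A. \<Sum>j\<in>{j \<in> B. j \<in> P x}. f x * g j)"
    by (intro sum.cong refl) (simp only: P sum_distrib_left)
  also have "\<dots> = (\<Sum>j\<in>B. \<Sum>x\<in>{x \<in> A. j \<in> P x}. f x * g j)"
    by (rule sum.swap_restrict[OF assms(1,2)])
  also have "\<dots> = (\<Sum>j\<in>B. g j * sum f (Q j))"
    by (intro sum.cong refl) (simp only: Q sum_distrib_left mult.commute)
  finally show ?thesis .
qed

text \<open>The transposes of the two record recursions: a weighted sum of the sums for the longer word,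
  rewritten as a weighted sum of those for the shorter one.\<close>

lemma weighted_record_recursion_plus:
  fixes K D :: "nat \<Rightarrow> nat"
  shows "(\<Sum>x\<le>Suc n. K x * (x * D x + M * (\<Sum>j=x..<n + 1. D (Suc j)))) =
    (\<Sum>j\<le>n. D (Suc j) * (Suc j * K (Suc j) + M * (\<Sum>x\<le>j. K x)))"
proof -
  have "(\<Sum>x\<le>Suc n. K x * (x * D x)) = (\<Sum>j\<le>n. D (Suc j) * (Suc j * K (Suc j)))"
    by (subst sum.atMost_Suc_shift) (simp add: ac_simps del: mult_Suc mult_Suc_right)
  moreover have "(\<Sum>x\<le>Suc n. K x * (\<Sum>j=x..<n + 1. D (Suc j))) = (\<Sum>j\<le>n. D (Suc j) * (\<Sum>x\<le>j. K x))"
    by (rule sum_swap_weighted) auto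
  ultimately show ?thesis
    by (simp only: distrib_left sum.distrib mult.left_commute[of _ M] flip: sum_distrib_left)
qed

lemma weighted_record_recursion_minus:
  fixes K D :: "nat \<Rightarrow> nat"
  shows "(\<Sum>x\<le>Suc n. K x * ((n + 1 - x) * D (Suc x) + M * (\<Sum>j<x. D (Suc j)))) =
    (\<Sum>j\<le>n. D (Suc j) * (Suc (n - j) * K j + M * (\<Sum>x=Suc j..Suc n. K x)))"
proof -
  have "(\<Sum>x\<le>Suc n. K x * ((n + 1 - x) * D (Suc x))) = (\<Sum>j\<le>n. D (Suc j) * (Suc (n - j) * K j))"
    by (simp add: ac_simps Suc_diff_le del: mult_Suc mult_Suc_right)
  moreover have "(\<Sum>x\<le>Suc n. K x * (\<Sum>j<x. D (Suc j))) = (\<Sum>j\<le>n. D (Suc j) * (\<Sum>x=Suc j..Suc n. K x))"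
    by (rule sum_swap_weighted) auto
  ultimately show ?thesis
    by (simp only: distrib_left sum.distrib mult.left_commute[of _ M] flip: sum_distrib_left)
qed

section \<open>Words of length at most \<open>m - 1\<close>\<close>

text \<open>Short words: up to normalisation, the endpoint count is a hypergeometric average of record
  sums. For the empty word both are \<open>1\<close>; the step compares coefficients of \<open>D (Suc j)\<close> and
  uses the dual kernel identities.\<close>

lemma endpoint_count_by_record_sum:
  assumes "length w \<le> p" "y \<le> p"
  shows "fact p * endpoint_count (Suc p) w (Suc y) = fact (p - length w) *
    (\<Sum>x\<le>length w. (y choose x) * (p - y choose (length w - x)) * record_sum (Suc p) w (Suc x))"
  using assms
proof (induction w arbitrary: y)
  case Nil
  then show ?case by (simp add: endpoint_count_Nil record_sum_Nil)
next
  case (Cons s w)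
  define n where "n = length w"
  define c where "c = (\<lambda>i. endpoint_count (Suc p) w (Suc i))"
  define D where "D = record_sum (Suc p) w"
  define K where "K = (\<lambda>x. (y choose x) * (p - y choose (Suc n - x)))"
  have n: "n < p" using Cons.prems by (simp add: n_def)
  have fact: "fact (p - n) = fact (p - Suc n) * (p - n)"
    using n by (metis Suc_diff_Suc fact_Suc mult.commute of_nat_id)
  have IH: "fact p * c i = fact (p - n) *
      (\<Sum>j\<le>n. D (Suc j) * ((i choose j) * (p - i choose (n - j))))" if "i \<le> p" for i
    using Cons.IH[of i] that n by (simp add: c_def D_def n_def mult.commute)
  have sum_c: "fact p * sum c I = fact (p - Suc n) *
      (\<Sum>j\<le>n. D (Suc j) * ((p - n) * (\<Sum>i\<in>I. (i choose j) * (p - i choose (n - j)))))"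
    if "I \<subseteq> {..p}" for I
  proof -
    have "fact p * sum c I = (\<Sum>i\<in>I. fact (p - n) * (\<Sum>j\<le>n. D (Suc j) * ((i choose j) * (p - i choose (n - j)))))"
      unfolding sum_distrib_left[of _ c] using that by (intro sum.cong refl IH) auto
    also have "\<dots> = fact (p - n) * (\<Sum>j\<le>n. D (Suc j) * (\<Sum>i\<in>I. (i choose j) * (p - i choose (n - j))))"
      by (simp only: sum_distrib_left sum.swap[of _ I])
    finally show ?thesis
      by (simp add: fact sum_distrib_left mult_ac)
  qed
  show ?case
  proof (cases s)
    case Plus
    have kernel: "(p - n) * (\<Sum>i=y..p. (i choose j) * (p - i choose (n - j))) =
        Suc j * K (Suc j) + Suc p * (\<Sum>x\<le>j. K x)" if "j \<le> n" for j
      using short_word_kernel_plus[of j "n - j" y "p - y"] that n Cons.prems by (simp add: K_def mult.assoc del: mult_Suc mult_Suc_right)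
    have "fact p * endpoint_count (Suc p) (s # w) (Suc y) = fact p * sum c {y..p}"
      using Cons.prems by (simp add: Plus endpoint_count_Plus c_def)
    also have "\<dots> = fact (p - Suc n) *
        (\<Sum>j\<le>n. D (Suc j) * (Suc j * K (Suc j) + Suc p * (\<Sum>x\<le>j. K x)))"
      by (subst sum_c, force, intro arg_cong2[of _ _ _ _ "(*)"] sum.cong refl)
        (simp only: kernel atMost_iff)
    also have "\<dots> = fact (p - Suc n) *
        (\<Sum>x\<le>Suc n. K x * (x * D x + Suc p * (\<Sum>j=x..<n + 1. D (Suc j))))"
      by (simp only: weighted_record_recursion_plus)
    also have "\<dots> = fact (p - Suc n) * (\<Sum>x\<le>Suc n. K x * record_sum (Suc p) (s # w) (Suc x))"
      by (intro arg_cong2[of _ _ _ _ "(*)"] sum.cong refl)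
        (simp add: Plus D_def n_def record_sum_Plus del: sum.op_ivl_Suc mult_Suc mult_Suc_right)
    finally show ?thesis by (simp add: K_def n_def)
  next
    case Minus
    have kernel: "(p - n) * (\<Sum>i\<le>y. (i choose j) * (p - i choose (n - j))) =
        Suc (n - j) * K j + Suc p * (\<Sum>x=Suc j..Suc n. K x)" if "j \<le> n" for j
      using short_word_kernel_minus[of j "n - j" y "p - y"] that n Cons.prems by (simp add: K_def mult.assoc Suc_diff_le del: mult_Suc mult_Suc_right)
    have "fact p * endpoint_count (Suc p) (s # w) (Suc y) = fact p * sum c {..y}"
      using Cons.prems by (simp add: Minus endpoint_count_Minus c_def)
    also have "\<dots> = fact (p - Suc n) *
        (\<Sum>j\<le>n. D (Suc j) * (Suc (n - j) * K j + Suc p * (\<Sum>x=Suc j..Suc n. K x)))"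
      by (subst sum_c, use Cons.prems in force, intro arg_cong2[of _ _ _ _ "(*)"] sum.cong refl)
        (simp only: kernel atMost_iff)
    also have "\<dots> = fact (p - Suc n) *
        (\<Sum>x\<le>Suc n. K x * ((n + 1 - x) * D (Suc x) + Suc p * (\<Sum>j<x. D (Suc j))))"
      by (simp only: weighted_record_recursion_minus)
    also have "\<dots> = fact (p - Suc n) * (\<Sum>x\<le>Suc n. K x * record_sum (Suc p) (s # w) (Suc x))"
      by (intro arg_cong2[of _ _ _ _ "(*)"] sum.cong refl)
        (simp add: Minus D_def n_def record_sum_Minus del: sum.op_ivl_Suc mult_Suc mult_Suc_right)
    finally show ?thesis by (simp add: K_def n_def)
  qed
qed

section \<open>Words of length at least \<open>m - 1\<close>\<close>

text \<open>At \<open>length w = p\<close> the hypergeometric kernel is diagonal: a sample of all \<open>p\<close> points has exactly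
  \<open>y\<close> members among the first \<open>y\<close>.\<close>

lemma choose_mult_choose_complement:
  assumes "x \<le> p" "y \<le> p"
  shows "(y choose x) * (p - y choose (p - x)) = (if x = y then 1 else 0)"
  using assms by (auto simp: binomial_eq_0_iff)

lemma record_sum_eq_endpoint_count_balanced:
  assumes "x \<le> length w"
  shows "record_sum (length w + 1) w (Suc x) = fact (length w) * endpoint_count (length w + 1) w (Suc x)"
  using endpoint_count_by_record_sum[of w "length w" x] assms
  by (simp add: choose_mult_choose_complement if_distrib[of "\<lambda>t. t * _"] cong: if_cong)

text \<open>Long words, starting from \<open>length w = p\<close>. The step compares coefficients of \<open>c i\<close>.\<close>

lemma record_sum_by_endpoint_count:
  assumes "p \<le> length w" "x \<le> length w"
  shows "record_sum (Suc p) w (Suc x) = fact p * fact (length w - p) *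
    (\<Sum>y\<le>p. (x choose y) * (length w - x choose (p - y)) * endpoint_count (Suc p) w (Suc y))"
proof -
  have base: "record_sum (Suc p) w (Suc x) = fact p * fact (length w - p) *
      (\<Sum>y\<le>p. (x choose y) * (length w - x choose (p - y)) * endpoint_count (Suc p) w (Suc y))"
    if "length w = p" "x \<le> length w" for w x
    using record_sum_eq_endpoint_count_balanced[of x w] that
    by (simp add: choose_mult_choose_complement if_distrib[of "\<lambda>t. t * _"] cong: if_cong)
  show ?thesis using assms
  proof (induction w arbitrary: x)
    case Nil
    then show ?case by (intro base) auto
  next
    case (Cons s w)
    define n where "n = length w"
    define c where "c = (\<lambda>i. endpoint_count (Suc p) w (Suc i))"
    define D where "D = record_sum (Suc p) w"
    define K where "K = (\<lambda>y. (x choose y) * (Suc n - x choose (p - y)))"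
    show ?case
    proof (cases "p = Suc n")
      case True
      then show ?thesis using Cons.prems by (intro base) (auto simp: n_def)
    next
      case False
      then have n: "p \<le> n" and x: "x \<le> Suc n" using Cons.prems by (auto simp: n_def)
      have fact: "fact (Suc n - p) = fact (n - p) * (Suc n - p)"
        using n by (simp add: Suc_diff_le)
      have IH: "D (Suc j) = fact p * fact (n - p) * (\<Sum>i\<le>p. c i * ((j choose i) * (n - j choose (p - i))))"
        if "j \<le> n" for j
        using Cons.IH[of j] that n by (simp add: c_def D_def n_def mult.commute)
      have sum_D: "(\<Sum>j\<in>J. D (Suc j)) = fact p * fact (n - p) *
          (\<Sum>i\<le>p. c i * (\<Sum>j\<in>J. (j choose i) * (n - j choose (p - i))))" if "J \<subseteq> {..n}" for J
      proof -
        have "(\<Sum>j\<in>J. D (Suc j)) = (\<Sum>j\<in>J. fact p * fact (n - p) * (\<Sum>i\<le>p. c i * ((j choose i) * (n - j choose (p - i)))))"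
          using that by (intro sum.cong refl IH) auto
        then show ?thesis
          by (simp only: sum_distrib_left sum.swap[of _ J])
      qed
      show ?thesis
      proof (cases s)
        case Plus
        have kernel: "x * ((x - 1 choose i) * (Suc n - x choose (p - i))) +
            Suc p * (\<Sum>j=x..<n + 1. (j choose i) * (n - j choose (p - i))) = (Suc n - p) * (\<Sum>y\<le>i. K y)"
          if "i \<le> p" for i
          using long_word_kernel_plus[of i "p - i" x "Suc n - x"] that n x by (simp add: K_def mult.assoc del: mult_Suc mult_Suc_right)
        have "x * D x = fact p * fact (n - p) *
            (\<Sum>i\<le>p. c i * (x * ((x - 1 choose i) * (Suc n - x choose (p - i)))))"
        proof (cases x)
          case (Suc x')
          then show ?thesis using IH[of x'] x by (simp add: sum_distrib_left mult_ac del: mult_Suc mult_Suc_right)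
        qed simp
        moreover have "record_sum (Suc p) (s # w) (Suc x) = x * D x + Suc p * (\<Sum>j=x..<n + 1. D (Suc j))"
          using x by (simp add: Plus record_sum_Plus D_def n_def)
        moreover have "(\<Sum>j=x..<n + 1. D (Suc j)) = fact p * fact (n - p) *
            (\<Sum>i\<le>p. c i * (\<Sum>j=x..<n + 1. (j choose i) * (n - j choose (p - i))))"
          by (rule sum_D) auto
        ultimately have "record_sum (Suc p) (s # w) (Suc x) = fact p * fact (n - p) *
            (\<Sum>i\<le>p. c i * (x * ((x - 1 choose i) * (Suc n - x choose (p - i))) +
              Suc p * (\<Sum>j=x..<n + 1. (j choose i) * (n - j choose (p - i)))))"
          by (simp only: distrib_left sum.distrib sum_distrib_left mult_ac)
        also have "\<dots> = fact p * fact (n - p) * (\<Sum>i\<le>p. c i * ((Suc n - p) * (\<Sum>y\<le>i. K y)))"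
          by (intro arg_cong2[of _ _ _ _ "(*)"] sum.cong refl) (simp only: kernel atMost_iff)
        also have "\<dots> = fact p * fact (Suc n - p) * (\<Sum>i\<le>p. c i * (\<Sum>y\<le>i. K y))"
          by (simp only: fact sum_distrib_left mult_ac)
        also have "(\<Sum>i\<le>p. c i * (\<Sum>y\<le>i. K y)) = (\<Sum>y\<le>p. K y * (\<Sum>i=y..p. c i))"
          by (rule sum_swap_weighted) auto
        also have "\<dots> = (\<Sum>y\<le>p. K y * endpoint_count (Suc p) (s # w) (Suc y))"
          by (simp add: Plus endpoint_count_Plus c_def)
        finally show ?thesis by (simp add: K_def n_def)
      next
        case Minus
        have kernel: "(Suc n - x) * ((x choose i) * (n - x choose (p - i))) +
            Suc p * (\<Sum>j<x. (j choose i) * (n - j choose (p - i))) = (Suc n - p) * (\<Sum>y=i..p. K y)"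
          if "i \<le> p" for i
          using long_word_kernel_minus[of i "p - i" x "Suc n - x"] that n x by (simp add: K_def mult.assoc del: mult_Suc mult_Suc_right)
        have "(Suc n - x) * D (Suc x) = fact p * fact (n - p) *
            (\<Sum>i\<le>p. c i * ((Suc n - x) * ((x choose i) * (n - x choose (p - i)))))"
        proof (cases "x \<le> n")
          case True
          then show ?thesis by (simp only: IH sum_distrib_left mult_ac)
        qed (use x in simp)
        moreover have "record_sum (Suc p) (s # w) (Suc x) = (Suc n - x) * D (Suc x) + Suc p * (\<Sum>j<x. D (Suc j))"
          using x by (simp add: Minus record_sum_Minus D_def n_def)
        moreover have "(\<Sum>j<x. D (Suc j)) = fact p * fact (n - p) *
            (\<Sum>i\<le>p. c i * (\<Sum>j<x. (j choose i) * (n - j choose (p - i))))"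
          using x by (intro sum_D) auto
        ultimately have "record_sum (Suc p) (s # w) (Suc x) = fact p * fact (n - p) *
            (\<Sum>i\<le>p. c i * ((Suc n - x) * ((x choose i) * (n - x choose (p - i))) +
              Suc p * (\<Sum>j<x. (j choose i) * (n - j choose (p - i)))))"
          by (simp only: distrib_left sum.distrib sum_distrib_left mult_ac)
        also have "\<dots> = fact p * fact (n - p) * (\<Sum>i\<le>p. c i * ((Suc n - p) * (\<Sum>y=i..p. K y)))"
          by (intro arg_cong2[of _ _ _ _ "(*)"] sum.cong refl) (simp only: kernel atMost_iff)
        also have "\<dots> = fact p * fact (Suc n - p) * (\<Sum>i\<le>p. c i * (\<Sum>y=i..p. K y))"
          by (simp only: fact sum_distrib_left mult_ac)
        also have "(\<Sum>i\<le>p. c i * (\<Sum>y=i..p. K y)) = (\<Sum>y\<le>p. K y * (\<Sum>i\<le>y. c i))"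
          by (rule sum_swap_weighted) auto
        also have "\<dots> = (\<Sum>y\<le>p. K y * endpoint_count (Suc p) (s # w) (Suc y))"
          by (simp add: Minus endpoint_count_Minus c_def)
        finally show ?thesis by (simp add: K_def n_def)
      qed
    qed
  qed
qed

section \<open>Record sums from endpoint counts\<close>

text \<open>Both sides are the same quotient of factorials when all differences are nonnegative, and vanish
  together otherwise. The hypergeometric form is the one that puts \<open>x\<close> and \<open>r - x\<close> on top, as the
  record recursion needs.\<close>

lemma record_kernel_hypergeometric:
  assumes "y \<le> p" "p \<le> r" "x \<le> r"
  shows "record_kernel (Suc p) r (Suc x) (Suc y) =
    fact p * fact (r - p) * ((x choose y) * (r - x choose (p - y)))"
proof (cases "y \<le> x \<and> p - y \<le> r - x")
  case True
  then obtain a b c where eqs: "x = y + a" "p = y + b" "r = y + a + b + c"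
    using assms by (metis add.assoc le_Suc_ex le_add_diff_inverse diff_add_inverse add.left_commute)
  have "real (fact x * fact (r - x) * (p choose y) * (r - p choose a)) =
      real (fact p * fact (r - p) * ((x choose y) * (r - x choose (p - y))))"
    by (simp add: eqs binomial_fact ac_simps)
  then have "fact x * fact (r - x) * (p choose y) * (r - p choose a) =
      fact p * fact (r - p) * ((x choose y) * (r - x choose (p - y)))"
    by (simp only: of_nat_eq_iff)
  then show ?thesis by (simp add: record_kernel_def binom_def eqs)
next
  case False
  then consider "x < y" | "y \<le> x" "r - x < p - y" by linarith
  then show ?thesis
  proof cases
    case 2
    then have "r - p < nat (int (Suc x) - int (Suc y))" using assms by linarith
    then show ?thesis using 2 by (simp add: record_kernel_def binom_def binomial_eq_0)
  qed (simp add: record_kernel_def binom_def)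
qed

theorem theorem5p8:
  fixes m r k :: nat and w :: "sign list"
  assumes "m \<ge> 1"
    and "length w = r"
    and "r \<ge> m - 1"
    and "1 \<le> k" and "k \<le> r + 1"
  shows "record_sum m w k = (\<Sum>l = 1..m. endpoint_count m w l * record_kernel m r k l)"
proof -
  obtain p where m: "m = Suc p" using assms(1) by (cases m) auto
  obtain x where k: "k = Suc x" using assms(4) by (cases k) auto
  have "record_sum m w k = (\<Sum>y\<le>p. fact p * fact (r - p) *
      ((x choose y) * (r - x choose (p - y))) * endpoint_count m w (Suc y))"
    using record_sum_by_endpoint_count[of p w x] assms
    by (simp add: m k sum_distrib_left mult.assoc)
  also have "\<dots> = (\<Sum>y\<le>p. endpoint_count m w (Suc y) * record_kernel m r k (Suc y))"
    using assms by (intro sum.cong refl) (simp add: m k record_kernel_hypergeometric mult.commute)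
  also have "\<dots> = (\<Sum>l = 1..m. endpoint_count m w l * record_kernel m r k l)"
    by (rule sum.reindex_bij_witness[of _ "\<lambda>l. l - 1" Suc]) (auto simp: m)
  finally show ?thesis .
qed

end
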